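(* Let $h>0$, let $S$ be any higher-order predictor, with original calibration functions $\eta_1^{\mathrm{orig}},\eta_2^{\mathrm{orig}}$, and let $\eta_1,\eta_2$ be the calibration functions of the predictor obtained from $S$ by the $\mathrm{sech}$ perturbation with bandwidth $h$ (the product perturbation in the two-dimensional case). (1D) If $S(x)=m(x)\in[0,1]$ is a scalar score, then $\eta_1$ is analytic in $\{z\in\mathbb{C}: |\mathrm{Im}(z)|<h\pi/2\}\cap\{z\in\mathbb{C}: 0\le \mathrm{Re}(z)\le 1\}$. (2D) For the full score $S(x)=(m(x),\sigma^2(x))$ with product perturbation, for each $j\in\{1,2\}$ the function $\eta_j$ is analytic in its first variable $m$ in the strip $|\mathrm{Im}(m)|<h\pi/2$ for each fixed real value of the second variable $\sigma^2$, and analytic in its second variable $\sigma^2$ in the strip $|\mathrm{Im}(\sigma^2)|<h\pi/2$ for each fixed real value of the first variable $m$.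
   Context: Setting: $X$ is a random input, $Y\in\{0,1\}$ a label, $f^*(x)=P(Y=1\mid X=x)$; no assumptions are made on $f^*$ or the law of $X$. A higher-order predictor is a (measurable) map $x\mapsto S(x)=(m(x),\sigma^2(x))$ with $m\in[0,1]$ and $\sigma^2\in[0,m(1-m)]$; in the 1D case only the scalar score $m(x)\in[0,1]$ is used. Its calibration functions are $\eta_1^{\mathrm{orig}}(s)=\mathbb{E}[Y\mid S(X)=s]$ and $\eta_2^{\mathrm{orig}}(s)=\mathbb{E}[f^*(X)^2\mid S(X)=s]$. Sech perturbation: for a score $s\in[a,b]$ and $h>0$, the kernel is the probability density $k_h(t\mid s)=\frac{\mathrm{sech}((t-s)/h)}{Z(s,h)}\mathbf{1}_{[a,b]}(t)$, with $Z(s,h)=\int_a^b\mathrm{sech}((u-s)/h)\,du$; write $Z_{[a,b]}$ to indicate the interval. In 1D the perturbed score is drawn from $k_h(\cdot\mid m(X))$ on $[0,1]$. In 2D (product perturbation) the two coordinates of the perturbed score are drawn independently, the first from $k_h(\cdot\mid m(X))$ on $[0,1]$ and the second from $k_h(\cdot\mid\sigma^2(X))$ on $[0,\tfrac14]$. The perturbation noise is independent of everything else given the original score. The calibration functions of the perturbed predictor are the conditional expectations $\eta_1=\mathbb{E}[Y\mid\text{perturbed score}=\cdot]$ and $\eta_2=\mathbb{E}[f^*(X)^2\mid\text{perturbed score}=\cdot]$, understood as the versions given by Bayes' formula: in 1D $$\eta_1(t)=\frac{\mathbb{E}\big[\eta_1^{\mathrm{orig}}(m(X))\,Z_{[0,1]}(m(X),h)^{-1}\,\mathrm{sech}((t-m(X))/h)\big]}{\mathbb{E}\big[Z_{[0,1]}(m(X),h)^{-1}\,\mathrm{sech}((t-m(X))/h)\big]},$$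 and in 2D $$\eta_j(t,u)=\frac{\mathbb{E}\big[\eta_j^{\mathrm{orig}}(S(X))\,w(X)\,\mathrm{sech}((t-m(X))/h)\,\mathrm{sech}((u-\sigma^2(X))/h)\big]}{\mathbb{E}\big[w(X)\,\mathrm{sech}((t-m(X))/h)\,\mathrm{sech}((u-\sigma^2(X))/h)\big]},$$ with $w(X)=\big(Z_{[0,1]}(m(X),h)\,Z_{[0,1/4]}(\sigma^2(X),h)\big)^{-1}$. "Analytic" in a complex set means that the same formula, with complex argument, defines an analytic function there. *)

theory Defs
  imports "HOL-Probability.Probability"
begin

text \<open>\<open>g\<close> is a version of \<open>t \<mapsto> E[W | T = t]\<close>, for \<open>T\<close> with values in \<open>N\<close>.\<close>

definition cond_exp_given ::
  "'w measure \<Rightarrow> 'b measure \<Rightarrow> ('w \<Rightarrow> 'b) \<Rightarrow> ('w \<Rightarrow> real) \<Rightarrow> ('b \<Rightarrow> real) \<Rightarrow> bool"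
  where "cond_exp_given M N T W g \<longleftrightarrow>
    g \<in> borel_measurable N \<and>
    (AE \<omega> in M. g (T \<omega>) = real_cond_exp M (vimage_algebra (space M) T N) W \<omega>)"

definition scalar_predictor :: "'x measure \<Rightarrow> ('x \<Rightarrow> real) \<Rightarrow> bool"
  where "scalar_predictor N m \<longleftrightarrow>
    m \<in> borel_measurable N \<and> (\<forall>x\<in>space N. m x \<in> {0..1})"

definition higher_order_predictor :: "'x measure \<Rightarrow> ('x \<Rightarrow> real \<times> real) \<Rightarrow> bool"
  where "higher_order_predictor N S \<longleftrightarrow>
    S \<in> borel_measurable N \<and>
    (\<forall>x\<in>space N. fst (S x) \<in> {0..1} \<and> snd (S x) \<in> {0..fst (S x) * (1 - fst (S x))})"

definition sech :: "'a \<Rightarrow> 'a::{real_normed_field,banach}"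
  where "sech z = inverse (cosh z)"

definition sech_norm :: "real \<Rightarrow> real \<Rightarrow> real \<Rightarrow> real \<Rightarrow> real"
  where "sech_norm a b s h = (LBINT u:{a..b}. sech ((u - s) / h))"

definition sech_kernel :: "real \<Rightarrow> real \<Rightarrow> real \<Rightarrow> real \<Rightarrow> real \<Rightarrow> real"
  where "sech_kernel a b h s t = sech ((t - s) / h) / sech_norm a b s h * indicator {a..b} t"

text \<open>Bayes' formula for the calibration function of the perturbed score, \<open>\<eta>\<close> being that of the
  original one.  The type of the arguments is kept polymorphic so that the real calibration
  function and the same formula with a complex argument are instances of one definition; the
  cut-off by the indicator in the kernel is dropped, as it is 1 on the support
  of the perturbed score.\<close>

definition perturbed_calibration ::
  "'w measure \<Rightarrow> real \<Rightarrow> ('w \<Rightarrow> 'x) \<Rightarrow> ('x \<Rightarrow> real) \<Rightarrow> (real \<Rightarrow> real) \<Rightarrow>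
    'a \<Rightarrow> 'a::{real_normed_field,banach,second_countable_topology}"
  where "perturbed_calibration M h X m \<eta> t =
    (\<integral>\<omega>. of_real (\<eta> (m (X \<omega>))) * of_real (inverse (sech_norm 0 1 (m (X \<omega>)) h))
           * sech ((t - of_real (m (X \<omega>))) / of_real h) \<partial>M) /
    (\<integral>\<omega>. of_real (inverse (sech_norm 0 1 (m (X \<omega>)) h))
           * sech ((t - of_real (m (X \<omega>))) / of_real h) \<partial>M)"

definition product_weight :: "real \<Rightarrow> real \<times> real \<Rightarrow> real"
  where "product_weight h s = inverse (sech_norm 0 1 (fst s) h * sech_norm 0 (1/4) (snd s) h)"

definition perturbed_calibration2 ::
  "'w measure \<Rightarrow> real \<Rightarrow> ('w \<Rightarrow> 'x) \<Rightarrow> ('x \<Rightarrow> real \<times> real) \<Rightarrow> (real \<times> real \<Rightarrow> real) \<Rightarrow>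
    'a \<Rightarrow> 'a \<Rightarrow> 'a::{real_normed_field,banach,second_countable_topology}"
  where "perturbed_calibration2 M h X S \<eta> t u =
    (\<integral>\<omega>. of_real (\<eta> (S (X \<omega>))) * of_real (product_weight h (S (X \<omega>)))
           * sech ((t - of_real (fst (S (X \<omega>)))) / of_real h)
           * sech ((u - of_real (snd (S (X \<omega>)))) / of_real h) \<partial>M) /
    (\<integral>\<omega>. of_real (product_weight h (S (X \<omega>)))
           * sech ((t - of_real (fst (S (X \<omega>)))) / of_real h)
           * sech ((u - of_real (snd (S (X \<omega>)))) / of_real h) \<partial>M)"

lemma perturbed_calibration_eq_kernel:
  fixes t :: real
  assumes "t \<in> {0..1}"
  shows "perturbed_calibration M h X m \<eta> t =
    (\<integral>\<omega>. \<eta> (m (X \<omega>)) * sech_kernel 0 1 h (m (X \<omega>)) t \<partial>M) /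
    (\<integral>\<omega>. sech_kernel 0 1 h (m (X \<omega>)) t \<partial>M)"
  using assms by (simp add: perturbed_calibration_def sech_kernel_def field_simps)

lemma perturbed_calibration2_eq_kernel:
  fixes t u :: real
  assumes "t \<in> {0..1}" "u \<in> {0..1/4}"
  shows "perturbed_calibration2 M h X S \<eta> t u =
    (\<integral>\<omega>. \<eta> (S (X \<omega>)) * (sech_kernel 0 1 h (fst (S (X \<omega>))) t
             * sech_kernel 0 (1/4) h (snd (S (X \<omega>))) u) \<partial>M) /
    (\<integral>\<omega>. sech_kernel 0 1 h (fst (S (X \<omega>))) t * sech_kernel 0 (1/4) h (snd (S (X \<omega>))) u \<partial>M)"
  using assms
  by (simp add: perturbed_calibration2_def product_weight_def sech_kernel_def field_simps)

lemma cosh_complex_of_real: "cosh (complex_of_real x) = complex_of_real (cosh x)"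
  by (simp add: cosh_def exp_of_real scaleR_conv_of_real flip: of_real_minus)

lemma sech_complex_of_real: "sech (complex_of_real x) = complex_of_real (sech x)"
  by (simp add: sech_def cosh_complex_of_real)

lemma perturbed_calibration_complex_of_real:
  "perturbed_calibration M h X m \<eta> (complex_of_real t) =
    complex_of_real (perturbed_calibration M h X m \<eta> t)"
  by (simp add: perturbed_calibration_def sech_complex_of_real
      flip: of_real_diff of_real_divide of_real_mult of_real_inverse)

lemma perturbed_calibration2_complex_of_real:
  "perturbed_calibration2 M h X S \<eta> (complex_of_real t) (complex_of_real u) =
    complex_of_real (perturbed_calibration2 M h X S \<eta> t u)"
  by (simp add: perturbed_calibration2_def sech_complex_of_real
      flip: of_real_diff of_real_divide of_real_mult of_real_inverse)

end

theory Submission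
  imports Defs "HOL-Complex_Analysis.Complex_Analysis"
begin

text \<open>
  Since \<open>cosh (x + \<i> y)\<close> has real part \<open>cosh x cos y\<close>, in the strip \<open>\<bar>y\<bar> < \<pi> / 2\<close> the function
  \<open>sech\<close> is holomorphic, has positive real part and is bounded by \<open>1 / cos y\<close>.  So a mixture
  \<open>z \<mapsto> E[q sech ((z - s) / h)]\<close> with integrable weight \<open>q\<close> is holomorphic in the strip
  \<open>\<bar>Im z\<bar> < h \<pi> / 2\<close>, and it has no zero there if \<open>q > 0\<close>, because its real part is positive.
  Each calibration function is a quotient of two such mixtures; in the two-dimensional case the
  factor belonging to the fixed real variable is a positive bounded weight.
\<close>

section \<open>Holomorphy of integrals with a complex parameter\<close>

text \<open>Dominated convergence is applied to the difference quotients. A local majorant of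
  \<open>f\<close> alone suffices, since holomorphy then controls the derivative as well; the
  majorant may change with the point \<open>z\<close>.\<close>

lemma holomorphic_on_integral:
  fixes f :: "complex \<Rightarrow> 'a \<Rightarrow> complex"
  assumes "open U"
    and meas: "\<And>z. z \<in> U \<Longrightarrow> f z \<in> borel_measurable M"
    and hol: "\<And>\<omega>. \<omega> \<in> space M \<Longrightarrow> (\<lambda>z. f z \<omega>) holomorphic_on U"
    and dom: "\<And>z. z \<in> U \<Longrightarrow> \<exists>r>0. \<exists>g. integrable M g \<and>
      (\<forall>w\<in>ball z r \<inter> U. \<forall>\<omega>\<in>space M. norm (f w \<omega>) \<le> g \<omega>)"
  shows "(\<lambda>z. \<integral>\<omega>. f z \<omega> \<partial>M) holomorphic_on U"
  unfolding holomorphic_on_open[OF \<open>open U\<close>]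
proof
  fix z assume "z \<in> U"
  then obtain d g where "d > 0" and g: "integrable M g"
    and gb: "\<And>w \<omega>. w \<in> ball z d \<inter> U \<Longrightarrow> \<omega> \<in> space M \<Longrightarrow> norm (f w \<omega>) \<le> g \<omega>"
    using dom by meson
  obtain e where "e > 0" and e: "ball z e \<subseteq> U"
    using \<open>open U\<close> \<open>z \<in> U\<close> by (meson openE)
  \<comment> \<open>Halving leaves room for Cauchy circles: a closed disc of radius
    \<open>r / 2\<close> centred in \<open>ball z r\<close> stays inside
    \<open>ball z (2 * r)\<close>, where \<open>g\<close> still dominates.\<close>
  define r where "r = min d e / 2"
  have r: "r > 0" "ball z (2 * r) \<subseteq> ball z d \<inter> U"
    using \<open>d > 0\<close> \<open>e > 0\<close> e by (auto simp: r_def)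
  have zb: "z \<in> ball z r" and sub: "ball z r \<subseteq> U"
    using r by auto
  let ?F' = "\<lambda>\<omega>. deriv (\<lambda>w. f w \<omega>) z"
  have der: "((\<lambda>w. f w \<omega>) has_field_derivative deriv (\<lambda>w. f w \<omega>) w) (at w)"
    if "w \<in> U" "\<omega> \<in> space M" for w \<omega>
    using hol[OF that(2)] \<open>open U\<close> that(1) by (rule holomorphic_derivI)
  \<comment> \<open>Cauchy's inequality turns the bound on \<open>f\<close> into one on the difference quotients.\<close>
  have derb: "norm (deriv (\<lambda>w. f w \<omega>) w) \<le> g \<omega> / (r / 2)"
    if w: "w \<in> ball z r" and \<omega>: "\<omega> \<in> space M" for w \<omega>
  proof -
    have c: "cball w (r / 2) \<subseteq> ball z (2 * r)"
    proof
      fix x assume "x \<in> cball w (r / 2)"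
      then show "x \<in> ball z (2 * r)"
        using w r(1) dist_triangle[of z x w] by auto
    qed
    have h: "(\<lambda>w. f w \<omega>) holomorphic_on cball w (r / 2)"
      using hol[OF \<omega>] c r(2) by (meson holomorphic_on_subset le_inf_iff order_trans)
    have "norm ((deriv ^^ 1) (\<lambda>w. f w \<omega>) w) \<le> fact 1 * g \<omega> / (r / 2) ^ 1"
    proof (rule Cauchy_inequality)
      fix x assume "norm (w - x) = r / 2"
      then have "x \<in> cball w (r / 2)" by (simp add: dist_norm)
      then show "norm (f x \<omega>) \<le> g \<omega>" using gb c r(2) \<omega> by blast
    qed (use r(1) h in \<open>auto intro: holomorphic_on_subset holomorphic_on_imp_continuous_on\<close>)
    then show ?thesis by simp
  qed
  have lip: "norm ((f w \<omega> - f z \<omega>) / (w - z)) \<le> g \<omega> / (r / 2)"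
    if w: "w \<in> ball z r - {z}" and \<omega>: "\<omega> \<in> space M" for w \<omega>
  proof -
    \<comment> \<open>Mean value inequality on the convex ball, with the Cauchy bound on the
      derivative.\<close>
    have "norm (f w \<omega> - f z \<omega>) \<le> g \<omega> / (r / 2) * norm (w - z)"
    proof (rule field_differentiable_bound[OF convex_ball[of z r]])
      fix x assume "x \<in> ball z r"
      then show "((\<lambda>w. f w \<omega>) has_field_derivative deriv (\<lambda>w. f w \<omega>) x) (at x within ball z r)"
        using der \<omega> sub by (blast intro: has_field_derivative_at_within)
    qed (use derb w zb \<omega> in auto)
    then show ?thesis
      using w by (simp add: norm_divide divide_le_eq)
  qed
  have int: "integrable M (f w)" if "w \<in> ball z r" for w
  proof (rule Bochner_Integration.integrable_bound[OF g])
    show "f w \<in> borel_measurable M" using meas sub that by blast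
    have "w \<in> ball z d \<inter> U" using r that by (auto simp: subset_iff)
    then show "AE \<omega> in M. norm (f w \<omega>) \<le> norm (g \<omega>)"
      using gb by (intro AE_I2) (auto intro: order_trans[OF _ abs_ge_self])
  qed
  \<comment> \<open>Working within the ball keeps every approximating sequence where the bounds
    hold, and sequences are what dominated convergence handles. As the ball is open, the restriction
    disappears at the end.\<close>
  have "((\<lambda>w. (\<integral>\<omega>. f w \<omega> \<partial>M)) has_field_derivative (\<integral>\<omega>. ?F' \<omega> \<partial>M)) (at z within ball z r)"
    unfolding has_field_derivative_iff tendsto_at_iff_sequentially
  proof (intro allI impI)
    fix X assume X: "\<forall>i. X i \<in> ball z r - {z}" "X \<longlonglongrightarrow> z"
    have lim: "(\<lambda>i. (f (X i) \<omega> - f z \<omega>) / (X i - z)) \<longlonglongrightarrow> ?F' \<omega>" if "\<omega> \<in> space M" for \<omega>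
    proof -
      have "((\<lambda>w. f w \<omega>) has_field_derivative ?F' \<omega>) (at z within ball z r)"
        using der[OF \<open>z \<in> U\<close> that] by (rule has_field_derivative_at_within)
      then show ?thesis
        using X unfolding has_field_derivative_iff tendsto_at_iff_sequentially comp_def by blast
    qed
    have m: "(\<lambda>\<omega>. (f (X i) \<omega> - f z \<omega>) / (X i - z)) \<in> borel_measurable M" for i
    proof -
      have "X i \<in> U" using X(1) sub by blast
      then show ?thesis
        using meas \<open>z \<in> U\<close> by (intro borel_measurable_divide borel_measurable_diff) auto
    qed
    have "(\<lambda>i. \<integral>\<omega>. (f (X i) \<omega> - f z \<omega>) / (X i - z) \<partial>M) \<longlonglongrightarrow> (\<integral>\<omega>. ?F' \<omega> \<partial>M)"
    proof (rule integral_dominated_convergence)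
      show "?F' \<in> borel_measurable M"
        using m lim by (rule borel_measurable_LIMSEQ_metric)
      show "integrable M (\<lambda>\<omega>. g \<omega> / (r / 2))" using g by simp
    qed (use m lim lip X(1) in auto)
    moreover have "(\<integral>\<omega>. (f (X i) \<omega> - f z \<omega>) / (X i - z) \<partial>M) =
        ((\<integral>\<omega>. f (X i) \<omega> \<partial>M) - (\<integral>\<omega>. f z \<omega> \<partial>M)) / (X i - z)" for i
      using int[of "X i"] int[OF zb] X(1) by simp
    ultimately show "((\<lambda>y. ((\<integral>\<omega>. f y \<omega> \<partial>M) - (\<integral>\<omega>. f z \<omega> \<partial>M)) / (y - z)) \<circ> X) \<longlonglongrightarrow> (\<integral>\<omega>. ?F' \<omega> \<partial>M)"
      unfolding comp_def by (simp only:)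
  qed
  then show "\<exists>f'. ((\<lambda>z. \<integral>\<omega>. f z \<omega> \<partial>M) has_field_derivative f') (at z)"
    using at_within_open[OF zb open_ball] by auto
qed

section \<open>Bounds for \<open>sech\<close> in the strip and on the real line\<close>

lemma Re_cosh_complex: "Re (cosh z) = cosh (Re z) * cos (Im z)"
  by (simp add: cosh_conv_cos Re_cos cosh_def field_simps)

text \<open>Everything rests on \<open>0 < cos (Im z) \<le> Re (cosh z)\<close>, which holds because
  \<open>cosh\<close> is at least 1 on the reals. Inversion preserves the sign of the real part, and
  the norm dominates the real part.\<close>

lemma
  assumes "\<bar>Im z\<bar> < pi / 2"
  shows Re_sech_pos: "0 < Re (sech z)"
    and norm_sech_le: "norm (sech z) \<le> inverse (cos (Im z))"
    and cosh_strip_nonzero: "cosh z \<noteq> 0"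
proof -
  have c: "cos (Im z) > 0"
    using assms by (intro cos_gt_zero_pi) auto
  have le: "cos (Im z) \<le> Re (cosh z)"
    using c cosh_real_ge_1[of "Re z"] mult_right_mono[of 1 "cosh (Re z)" "cos (Im z)"]
    by (simp add: Re_cosh_complex)
  then show nz: "cosh z \<noteq> 0"
    using c by auto
  show "0 < Re (sech z)"
    using c le nz unfolding sech_def inverse_complex.sel
    by (intro divide_pos_pos) (auto simp: complex_eq_iff sum_power2_gt_zero_iff)
  have "cos (Im z) \<le> norm (cosh z)"
    using le complex_Re_le_cmod[of "cosh z"] by linarith
  then show "norm (sech z) \<le> inverse (cos (Im z))"
    using c by (simp add: sech_def norm_inverse le_imp_inverse_le)
qed

lemma sech_pos_real: "0 < sech (x :: real)"
  by (simp add: sech_def)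

lemma sech_le_one_real: "sech (x :: real) \<le> 1"
  by (simp add: sech_def inverse_le_1_iff cosh_real_ge_1)

lemma borel_measurable_sech_real [measurable]: "(sech :: real \<Rightarrow> real) \<in> borel_measurable borel"
  unfolding sech_def[abs_def]
  by (intro borel_measurable_continuous_onI continuous_intros) auto

lemma borel_measurable_sech_complex [measurable]:
  "(sech :: complex \<Rightarrow> complex) \<in> borel_measurable borel"
proof -
  have "(cosh :: complex \<Rightarrow> complex) \<in> borel_measurable borel"
    by (intro borel_measurable_continuous_onI continuous_intros)
  then show ?thesis
    unfolding sech_def[abs_def] by measurable
qed

section \<open>Mixtures of shifted and scaled copies of \<open>sech\<close>\<close>

lemma Im_strip_scaled:
  assumes "h > 0" "\<bar>Im z\<bar> < h * pi / 2"
  shows "\<bar>Im ((z - complex_of_real s) / complex_of_real h)\<bar> < pi / 2"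
  using assms by (simp add: field_simps)

lemma open_strip: "open {z. \<bar>Im z\<bar> < c}"
  by (intro open_Collect_less continuous_intros)

text \<open>The real shift \<open>s \<omega>\<close> leaves the imaginary part
  \<open>Im z / h\<close> unchanged, so the \<open>sech\<close> factor is bounded by a constant
  independent of \<open>\<omega>\<close>.\<close>

lemma sech_mixture_integrable:
  fixes h :: real
  assumes "h > 0" "integrable M q" and [measurable]: "s \<in> borel_measurable M"
    and z: "\<bar>Im z\<bar> < h * pi / 2"
  shows "integrable M (\<lambda>\<omega>. complex_of_real (q \<omega>) * sech ((z - of_real (s \<omega>)) / of_real h))"
proof (rule Bochner_Integration.integrable_bound)
  have [measurable]: "q \<in> borel_measurable M" using assms(2) by auto
  show "integrable M (\<lambda>\<omega>. q \<omega> * inverse (cos (Im z / h)))"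
    using assms(2) by simp
  show "(\<lambda>\<omega>. complex_of_real (q \<omega>) * sech ((z - of_real (s \<omega>)) / of_real h)) \<in> borel_measurable M"
    by measurable
  show "AE \<omega> in M. norm (complex_of_real (q \<omega>) * sech ((z - of_real (s \<omega>)) / of_real h))
      \<le> norm (q \<omega> * inverse (cos (Im z / h)))"
  proof (intro AE_I2)
    fix \<omega>
    have "norm (sech ((z - of_real (s \<omega>)) / of_real h)) \<le> inverse (cos (Im z / h))"
      using norm_sech_le[OF Im_strip_scaled[OF \<open>h > 0\<close> z]] by simp
    then show "norm (complex_of_real (q \<omega>) * sech ((z - of_real (s \<omega>)) / of_real h))
      \<le> norm (q \<omega> * inverse (cos (Im z / h)))"
      unfolding norm_mult by (intro mult_mono) (auto intro: order_trans[OF _ abs_ge_self] simp del: abs_inverse)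
  qed
qed

text \<open>The bound \<open>inverse (cos (Im z / h))\<close> blows up at the edge of the strip, so
  a majorant is available only locally; this is all that \<open>holomorphic_on_integral\<close> asks
  for.\<close>

lemma sech_mixture_holomorphic:
  fixes h :: real
  assumes h: "h > 0" and q: "integrable M q" and s[measurable]: "s \<in> borel_measurable M"
  shows "(\<lambda>z. \<integral>\<omega>. complex_of_real (q \<omega>) * sech ((z - of_real (s \<omega>)) / of_real h) \<partial>M)
    holomorphic_on {z. \<bar>Im z\<bar> < h * pi / 2}" (is "_ holomorphic_on ?U")
proof (rule holomorphic_on_integral)
  show "open ?U" by (rule open_strip)
  show "(\<lambda>\<omega>. complex_of_real (q \<omega>) * sech ((z - of_real (s \<omega>)) / of_real h))
      \<in> borel_measurable M" if "z \<in> ?U" for z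
    using sech_mixture_integrable[OF h q s] that by auto
  show "(\<lambda>z. complex_of_real (q \<omega>) * sech ((z - of_real (s \<omega>)) / of_real h)) holomorphic_on ?U" for \<omega>
  proof -
    have "(\<lambda>z. cosh ((z - of_real (s \<omega>)) / of_real h)) holomorphic_on ?U"
      unfolding cosh_field_def using h by (intro holomorphic_intros) auto
    then show ?thesis
      unfolding sech_def using cosh_strip_nonzero[OF Im_strip_scaled[OF h]]
      by (intro holomorphic_intros) auto
  qed
  show "\<exists>r>0. \<exists>g. integrable M g \<and> (\<forall>w\<in>ball z r \<inter> ?U. \<forall>\<omega>\<in>space M.
      norm (complex_of_real (q \<omega>) * sech ((w - of_real (s \<omega>)) / of_real h)) \<le> g \<omega>)"
    if z: "z \<in> ?U" for z
  proof -
    \<comment> \<open>The midpoint between \<open>\<bar>Im z\<bar>\<close> and the edge: the ball of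
      radius \<open>a - \<bar>Im z\<bar>\<close> around \<open>z\<close> stays in the smaller strip
      of half-width \<open>a\<close>, on which the cosine is at least
      \<open>cos (a / h) > 0\<close>.\<close>
    define a where "a = (\<bar>Im z\<bar> + h * pi / 2) / 2"
    have a: "\<bar>Im z\<bar> < a" "a < h * pi / 2" using z by (auto simp: a_def field_simps)
    have "norm (complex_of_real (q \<omega>) * sech ((w - of_real (s \<omega>)) / of_real h))
        \<le> \<bar>q \<omega>\<bar> * inverse (cos (a / h))" if w: "w \<in> ball z (a - \<bar>Im z\<bar>)" for w \<omega>
    proof -
      have "\<bar>Im w - Im z\<bar> < a - \<bar>Im z\<bar>"
        using w abs_Im_le_cmod[of "w - z"] by (simp add: dist_norm norm_minus_commute)
      then have Im_w: "\<bar>Im w\<bar> < a" by linarith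
      \<comment> \<open>Cosine decreases on \<open>[0, pi]\<close>, hence the passage to the
        absolute value, undone by evenness.\<close>
      have "cos (a / h) \<le> cos (\<bar>Im w\<bar> / h)"
        using a Im_w h by (intro cos_monotone_0_pi_le divide_right_mono) (auto simp: field_simps)
      moreover have "cos (\<bar>Im w\<bar> / h) = cos (Im w / h)"
        using cos_abs_real[of "Im w / h"] h by simp
      moreover have "cos (a / h) > 0"
        using a h by (intro cos_gt_zero_pi) (auto simp: field_simps)
      ultimately have "inverse (cos (Im w / h)) \<le> inverse (cos (a / h))"
        by (simp add: le_imp_inverse_le)
      moreover have "norm (sech ((w - of_real (s \<omega>)) / of_real h)) \<le> inverse (cos (Im w / h))"
        using norm_sech_le[OF Im_strip_scaled[OF h], of w "s \<omega>"] Im_w a by simp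
      ultimately show ?thesis
        unfolding norm_mult norm_of_real by (intro mult_left_mono) auto
    qed
    moreover have "integrable M (\<lambda>\<omega>. \<bar>q \<omega>\<bar> * inverse (cos (a / h)))"
      using q by simp
    ultimately show ?thesis
      using a by (intro exI[of _ "a - \<bar>Im z\<bar>"] conjI exI[of _ "\<lambda>\<omega>. \<bar>q \<omega>\<bar> * inverse (cos (a / h))"]) auto
  qed
qed

text \<open>Positive real weights keep the real part of the integrand positive pointwise, and
  strictness survives integration against a probability measure.\<close>

lemma (in prob_space) sech_mixture_nonzero:
  fixes h :: real
  assumes h: "h > 0" and p: "integrable M p" and s: "s \<in> borel_measurable M"
    and pos: "\<And>\<omega>. \<omega> \<in> space M \<Longrightarrow> 0 < p \<omega>" and z: "\<bar>Im z\<bar> < h * pi / 2"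
  shows "(\<integral>\<omega>. complex_of_real (p \<omega>) * sech ((z - of_real (s \<omega>)) / of_real h) \<partial>M) \<noteq> 0"
    (is "?I \<noteq> 0")
proof -
  note int = sech_mixture_integrable[OF h p s z]
  have "0 < expectation (\<lambda>\<omega>. Re (complex_of_real (p \<omega>) * sech ((z - of_real (s \<omega>)) / of_real h)))"
  proof (rule expectation_greater)
    show "AE \<omega> in M. 0 < Re (complex_of_real (p \<omega>) * sech ((z - of_real (s \<omega>)) / of_real h))"
      using pos Re_sech_pos[OF Im_strip_scaled[OF h z]] by (intro AE_I2) simp
  qed (use int in \<open>rule integrable_Re\<close>)
  then have "0 < Re ?I" using integral_Re[OF int] by simp
  then show ?thesis by auto
qed

text \<open>Common form of both cases: below, \<open>p\<close> is a kernel weight and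
  \<open>q\<close> is \<open>p\<close> times the original calibration function.\<close>

lemma (in prob_space) sech_mixture_ratio_analytic:
  fixes h :: real
  assumes h: "h > 0" and "integrable M q" and p: "integrable M p" and s: "s \<in> borel_measurable M"
    and pos: "\<And>\<omega>. \<omega> \<in> space M \<Longrightarrow> 0 < p \<omega>"
  shows "(\<lambda>z. (\<integral>\<omega>. complex_of_real (q \<omega>) * sech ((z - of_real (s \<omega>)) / of_real h) \<partial>M) /
      (\<integral>\<omega>. complex_of_real (p \<omega>) * sech ((z - of_real (s \<omega>)) / of_real h) \<partial>M))
    analytic_on {z. \<bar>Im z\<bar> < h * pi / 2}"
  unfolding analytic_on_open[OF open_strip]
proof (intro holomorphic_on_divide sech_mixture_holomorphic assms)
  fix z assume "z \<in> {z. \<bar>Im z\<bar> < h * pi / 2}"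
  then show "(\<integral>\<omega>. complex_of_real (p \<omega>) * sech ((z - of_real (s \<omega>)) / of_real h) \<partial>M) \<noteq> 0"
    by (intro sech_mixture_nonzero[OF h p s] pos) auto
qed

section \<open>Normalising constants of the kernels\<close>

text \<open>Since \<open>\<bar>u - s\<bar> \<le> b - a\<close> and \<open>sech\<close> decreases
  with the absolute value of its argument, the integrand is at least
  \<open>sech ((b - a) / h)\<close>. The bound is uniform in \<open>s\<close>, which makes the
  random weights bounded.\<close>

lemma sech_norm_lower:
  assumes "a < b" "h > 0" "s \<in> {a..b}"
  shows "(b - a) * sech ((b - a) / h) \<le> sech_norm a b s h"
proof -
  have "(b - a) * sech ((b - a) / h) = (LBINT u:{a..b}. sech ((b - a) / h))"
    using assms by (simp add: set_integral_const)
  also have "\<dots> \<le> (LBINT u:{a..b}. sech ((u - s) / h))"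
  proof (rule set_integral_mono)
    show "set_integrable lborel {a..b} (\<lambda>u. sech ((u - s) / h))"
      unfolding sech_def using assms
      by (intro borel_integrable_atLeastAtMost' continuous_intros) auto
    fix u assume "u \<in> {a..b}"
    then have "\<bar>u - s\<bar> \<le> b - a" using assms by auto
    then have "\<bar>(u - s) / h\<bar> \<le> (b - a) / h"
      using assms by (simp add: abs_divide divide_right_mono)
    then have "cosh ((u - s) / h) \<le> cosh ((b - a) / h)"
      by (metis abs_ge_zero cosh_real_abs cosh_real_nonneg_le_iff order_trans)
    then show "sech ((b - a) / h) \<le> sech ((u - s) / h)"
      by (simp add: sech_def le_imp_inverse_le)
  qed (auto intro!: borel_integrable_atLeastAtMost' continuous_intros)
  finally show ?thesis by (simp add: sech_norm_def)
qed

lemma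
  assumes "a < b" "h > 0" "s \<in> {a..b}"
  shows sech_norm_pos: "0 < sech_norm a b s h"
    and inverse_sech_norm_le: "inverse (sech_norm a b s h) \<le> inverse ((b - a) * sech ((b - a) / h))"
proof -
  have "0 < (b - a) * sech ((b - a) / h)"
    using assms(1) sech_pos_real by simp
  note bounds = this sech_norm_lower[OF assms]
  show "0 < sech_norm a b s h"
    using bounds by (rule less_le_trans)
  show "inverse (sech_norm a b s h) \<le> inverse ((b - a) * sech ((b - a) / h))"
    using bounds(2,1) by (rule le_imp_inverse_le)
qed

lemma borel_measurable_sech_norm [measurable]:
  "(\<lambda>s. sech_norm a b s h) \<in> borel_measurable borel"
  unfolding sech_norm_def set_lebesgue_integral_def by measurable

text \<open>Applied with the original calibration function as integrable factor and the kernel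
  weight as bounded factor.\<close>

lemma integrable_mult_bounded:
  fixes f g :: "'a \<Rightarrow> real"
  assumes "integrable M f" "g \<in> borel_measurable M"
    and "\<And>\<omega>. \<omega> \<in> space M \<Longrightarrow> \<bar>g \<omega>\<bar> \<le> B"
  shows "integrable M (\<lambda>\<omega>. f \<omega> * g \<omega>)"
proof (rule Bochner_Integration.integrable_bound)
  show "integrable M (\<lambda>\<omega>. B * f \<omega>)" using assms(1) by simp
  show "AE \<omega> in M. norm (f \<omega> * g \<omega>) \<le> norm (B * f \<omega>)"
  proof (intro AE_I2)
    fix \<omega> assume "\<omega> \<in> space M"
    then have "\<bar>f \<omega>\<bar> * \<bar>g \<omega>\<bar> \<le> \<bar>f \<omega>\<bar> * \<bar>B\<bar>"
      using assms(3)[of \<omega>] by (intro mult_left_mono) auto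
    then show "norm (f \<omega> * g \<omega>) \<le> norm (B * f \<omega>)"
      by (simp add: abs_mult mult.commute)
  qed
qed (use assms in measurable)

section \<open>Range of the full score and the product weight\<close>

text \<open>Expanding \<open>(m - 1/2)^2 \<ge> 0\<close> gives \<open>m * (1 - m) \<le> 1/4\<close>,
  so the second coordinate lies in the interval used for its kernel.\<close>

lemma higher_order_predictorD:
  assumes "higher_order_predictor N S" "x \<in> space N"
  shows "fst (S x) \<in> {0..1}" "snd (S x) \<in> {0..1/4}"
proof -
  have 1: "fst (S x) \<in> {0..1}" "snd (S x) \<in> {0..fst (S x) * (1 - fst (S x))}"
    using assms by (auto simp: higher_order_predictor_def)
  have "fst (S x) * (1 - fst (S x)) \<le> 1/4"
    using zero_le_power2[of "fst (S x) - 1/2"] by (simp add: power2_eq_square algebra_simps)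
  then show "fst (S x) \<in> {0..1}" "snd (S x) \<in> {0..1/4}" using 1 by auto
qed

lemma product_weight_pos:
  assumes "h > 0" "fst s \<in> {0..1}" "snd s \<in> {0..1/4}"
  shows "0 < product_weight h s"
  using assms by (auto simp: product_weight_def intro!: mult_pos_pos sech_norm_pos)

lemma product_weight_bounded:
  assumes "h > 0"
  shows "\<exists>B. \<forall>s. fst s \<in> {0..1} \<longrightarrow> snd s \<in> {0..1/4} \<longrightarrow> product_weight h s \<le> B"
proof (intro exI allI impI)
  fix s :: "real \<times> real" assume s: "fst s \<in> {0..1}" "snd s \<in> {0..1/4}"
  \<comment> \<open>The right-hand side is the witness. Its differences \<open>1 - 0\<close> and
    \<open>1/4 - 0\<close> stay unevaluated to match \<open>inverse_sech_norm_le\<close>.\<close>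
  have "inverse (sech_norm 0 1 (fst s) h) * inverse (sech_norm 0 (1/4) (snd s) h)
      \<le> inverse ((1 - 0) * sech ((1 - 0) / h)) * inverse ((1/4 - 0) * sech ((1/4 - 0) / h))"
    using s assms sech_norm_pos[of 0 1 h "fst s"] sech_norm_pos[of 0 "1/4" h "snd s"] sech_pos_real
    by (intro mult_mono inverse_sech_norm_le) (auto simp: less_imp_le)
  then show "product_weight h s \<le>
      inverse ((1 - 0) * sech ((1 - 0) / h)) * inverse ((1/4 - 0) * sech ((1/4 - 0) / h))"
    by (simp add: product_weight_def)
qed

lemma borel_measurable_product_weight [measurable]:
  "product_weight h \<in> borel_measurable borel"
  unfolding product_weight_def[abs_def] borel_prod[symmetric] by measurable

section \<open>Conditional expectations given a score\<close>

lemma finite_measure_subalgebra_vimage: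
  assumes "finite_measure M" "T \<in> measurable M N"
  shows "finite_measure_subalgebra M (vimage_algebra (space M) T N)"
  using assms
  by (auto simp: finite_measure_subalgebra_def finite_measure_subalgebra_axioms_def subalgebra_def
      sets_vimage_algebra2 measurable_space measurable_sets)

text \<open>Almost everywhere \<open>g (T \<omega>)\<close> equals a conditional expectation, which
  inherits integrability from \<open>W\<close>.\<close>

lemma cond_exp_given_integrable:
  assumes "finite_measure M" "T \<in> measurable M N" "cond_exp_given M N T W g" "integrable M W"
  shows "integrable M (\<lambda>\<omega>. g (T \<omega>))"
proof -
  interpret finite_measure_subalgebra M "vimage_algebra (space M) T N"
    using assms(1,2) by (rule finite_measure_subalgebra_vimage)
  have "integrable M (real_cond_exp M (vimage_algebra (space M) T N) W)"
    using assms(4) by (rule real_cond_exp_int)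
  then show ?thesis
    using assms(2,3) unfolding cond_exp_given_def
    by (subst integrable_cong_AE) (auto intro: measurable_compose)
qed

lemma cond_exp_given_AE_bounds:
  assumes "finite_measure M" "T \<in> measurable M N" "cond_exp_given M N T W g" "integrable M W"
    and "AE \<omega> in M. W \<omega> \<in> {a..b}"
  shows "AE \<omega> in M. g (T \<omega>) \<in> {a..b}"
proof -
  interpret finite_measure_subalgebra M "vimage_algebra (space M) T N"
    using assms(1,2) by (rule finite_measure_subalgebra_vimage)
  have "AE \<omega> in M. a \<le> real_cond_exp M (vimage_algebra (space M) T N) W \<omega>"
    using assms(4,5) by (intro real_cond_exp_ge_c) auto
  moreover have "AE \<omega> in M. real_cond_exp M (vimage_algebra (space M) T N) W \<omega> \<le> b"
    using assms(4,5) by (intro real_cond_exp_le_c) auto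
  ultimately show ?thesis
    using assms(3) unfolding cond_exp_given_def by auto
qed

section \<open>Analyticity of the perturbed calibration functions\<close>

lemma (in prob_space) perturbed_calibration_analytic:
  assumes "h > 0" and [measurable]: "X \<in> measurable M N" and m: "scalar_predictor N m"
    and \<eta>: "integrable M (\<lambda>\<omega>. \<eta> (m (X \<omega>)))"
  shows "perturbed_calibration M h X m \<eta> analytic_on {z :: complex. \<bar>Im z\<bar> < h * pi / 2}"
proof -
  have [measurable]: "m \<in> borel_measurable N"
    using m by (simp add: scalar_predictor_def)
  have range: "m (X \<omega>) \<in> {0..1}" if "\<omega> \<in> space M" for \<omega>
    using m measurable_space[OF assms(2) that] by (auto simp: scalar_predictor_def)
  let ?p = "\<lambda>\<omega>. inverse (sech_norm 0 1 (m (X \<omega>)) h)"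
  let ?B = "inverse ((1 - 0) * sech ((1 - 0) / h))"
  have [measurable]: "?p \<in> borel_measurable M"
    by measurable
  have pos: "0 < ?p \<omega>" if "\<omega> \<in> space M" for \<omega>
    using sech_norm_pos[of 0 1 h "m (X \<omega>)"] range[OF that] assms(1) by simp
  have le: "?p \<omega> \<le> ?B" if "\<omega> \<in> space M" for \<omega>
    using inverse_sech_norm_le[of 0 1 h "m (X \<omega>)"] range[OF that] assms(1) by simp
  have p: "integrable M ?p"
    using pos le by (intro integrable_const_bound[of _ ?B] AE_I2) (auto simp: less_imp_le)
  have q: "integrable M (\<lambda>\<omega>. \<eta> (m (X \<omega>)) * ?p \<omega>)"
    using pos le \<eta>
    by (intro integrable_mult_bounded[where B = ?B]) (auto simp: less_imp_le)
  show ?thesis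
    using sech_mixture_ratio_analytic[OF assms(1) q p _ pos, of "\<lambda>\<omega>. m (X \<omega>)"]
    unfolding perturbed_calibration_def[abs_def] of_real_mult by simp
qed

text \<open>At a fixed real value of one variable its \<open>sech\<close> factor is a real number in
  \<open>(0, 1]\<close>. Absorbed into the weight, it leaves a one-variable mixture.\<close>

lemma (in prob_space) perturbed_calibration2_analytic:
  assumes "h > 0" and [measurable]: "X \<in> measurable M N" and S: "higher_order_predictor N S"
    and \<eta>: "integrable M (\<lambda>\<omega>. \<eta> (S (X \<omega>)))"
  shows "(\<lambda>z. perturbed_calibration2 M h X S \<eta> z (complex_of_real u)) analytic_on
      {z :: complex. \<bar>Im z\<bar> < h * pi / 2}"
    and "(\<lambda>z. perturbed_calibration2 M h X S \<eta> (complex_of_real t) z) analytic_on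
      {z :: complex. \<bar>Im z\<bar> < h * pi / 2}"
proof -
  have [measurable]: "S \<in> borel_measurable N"
    using S by (simp add: higher_order_predictor_def)
  have [measurable]: "(fst :: real \<times> real \<Rightarrow> real) \<in> borel_measurable borel"
    "(snd :: real \<times> real \<Rightarrow> real) \<in> borel_measurable borel"
    unfolding borel_prod[symmetric] by measurable
  note range = higher_order_predictorD[OF S measurable_space[OF assms(2)]]
  obtain B where B: "\<And>s. fst s \<in> {0..1} \<Longrightarrow> snd s \<in> {0..1/4} \<Longrightarrow> product_weight h s \<le> B"
    using product_weight_bounded[OF assms(1)] by blast
  let ?r = "\<lambda>v x. sech ((v - x) / h)"
  \<comment> \<open>Here \<open>c\<close> projects onto the coordinate held fixed and
    \<open>v\<close> is its value, so \<open>c = snd\<close> serves the first claim and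
    \<open>c = fst\<close> the second.\<close>
  let ?p = "\<lambda>c v \<omega>. product_weight h (S (X \<omega>)) * ?r v (c (S (X \<omega>)))"
  have pos: "0 < ?p c v \<omega>" if "\<omega> \<in> space M" for c v \<omega>
    using product_weight_pos[OF assms(1) range] that sech_pos_real by simp
  have le: "?p c v \<omega> \<le> B" if "\<omega> \<in> space M" for c v \<omega>
  proof -
    have "?p c v \<omega> \<le> product_weight h (S (X \<omega>))"
      using product_weight_pos[OF assms(1) range] that sech_le_one_real[of "(v - c (S (X \<omega>))) / h"]
      by (intro mult_right_le_one_le) (auto simp: less_imp_le sech_pos_real)
    also have "\<dots> \<le> B" using B range that by blast
    finally show ?thesis .
  qed
  have p: "integrable M (?p c v)" and q: "integrable M (\<lambda>\<omega>. \<eta> (S (X \<omega>)) * ?p c v \<omega>)"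
    if [measurable]: "c \<in> borel_measurable borel" for c :: "real \<times> real \<Rightarrow> real" and v
  proof -
    have [measurable]: "?p c v \<in> borel_measurable M" by measurable
    show "integrable M (?p c v)"
      using pos le by (intro integrable_const_bound[of _ B] AE_I2) (auto simp: less_imp_le)
    show "integrable M (\<lambda>\<omega>. \<eta> (S (X \<omega>)) * ?p c v \<omega>)"
      using pos le \<eta> by (intro integrable_mult_bounded[where B = B]) (auto simp: less_imp_le)
  qed
  \<comment> \<open>Identifies the real factor hidden in the weight with the complex
    \<open>sech\<close> factor in \<open>perturbed_calibration2\<close>.\<close>
  have r: "complex_of_real (?r v x) = sech ((of_real v - of_real x) / of_real h)" for v x
    by (simp add: flip: sech_complex_of_real)
  show "(\<lambda>z. perturbed_calibration2 M h X S \<eta> z (complex_of_real u)) analytic_on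
      {z :: complex. \<bar>Im z\<bar> < h * pi / 2}"
    using sech_mixture_ratio_analytic[OF assms(1) q[of snd u] p[of snd u],
        where s = "\<lambda>\<omega>. fst (S (X \<omega>))"] pos
    unfolding perturbed_calibration2_def by (simp add: r mult_ac)
  show "(\<lambda>z. perturbed_calibration2 M h X S \<eta> (complex_of_real t) z) analytic_on
      {z :: complex. \<bar>Im z\<bar> < h * pi / 2}"
    using sech_mixture_ratio_analytic[OF assms(1) q[of fst t] p[of fst t],
        where s = "\<lambda>\<omega>. snd (S (X \<omega>))"] pos
    unfolding perturbed_calibration2_def by (simp add: r mult_ac)
qed

text \<open>What remains is integrability of the original calibration functions along the score. It
  follows from that of \<open>Y\<close> and of the square of \<open>fstar\<close>, both bounded
  almost everywhere.\<close>

theorem lemma1: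
  fixes M :: "'w measure" and N :: "'x measure"
    and X :: "'w \<Rightarrow> 'x" and Y :: "'w \<Rightarrow> real" and fstar :: "'x \<Rightarrow> real" and h :: real
  assumes "prob_space M"
    and "X \<in> measurable M N"
    and "Y \<in> borel_measurable M"
    and "\<And>\<omega>. \<omega> \<in> space M \<Longrightarrow> Y \<omega> \<in> {0, 1}"
    and "cond_exp_given M N X (indicator {\<omega> \<in> space M. Y \<omega> = 1}) fstar"
    and "h > 0"
  shows
    "(\<forall>(m :: 'x \<Rightarrow> real) (\<eta>1 :: real \<Rightarrow> real).
        scalar_predictor N m \<longrightarrow>
        cond_exp_given M borel (\<lambda>\<omega>. m (X \<omega>)) Y \<eta>1 \<longrightarrow>
        perturbed_calibration M h X m \<eta>1 analytic_on
          ({z :: complex. \<bar>Im z\<bar> < h * pi / 2} \<inter> {z. 0 \<le> Re z \<and> Re z \<le> 1})) \<and>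
     (\<forall>(S :: 'x \<Rightarrow> real \<times> real) (\<eta>1 :: real \<times> real \<Rightarrow> real) (\<eta>2 :: real \<times> real \<Rightarrow> real).
        higher_order_predictor N S \<longrightarrow>
        cond_exp_given M borel (\<lambda>\<omega>. S (X \<omega>)) Y \<eta>1 \<longrightarrow>
        cond_exp_given M borel (\<lambda>\<omega>. S (X \<omega>)) (\<lambda>\<omega>. (fstar (X \<omega>))\<^sup>2) \<eta>2 \<longrightarrow>
        (\<forall>\<eta> \<in> {\<eta>1, \<eta>2}.
          (\<forall>u :: real.
            (\<lambda>z. perturbed_calibration2 M h X S \<eta> z (complex_of_real u)) analytic_on
              {z :: complex. \<bar>Im z\<bar> < h * pi / 2}) \<and>
          (\<forall>t :: real.
            (\<lambda>z. perturbed_calibration2 M h X S \<eta> (complex_of_real t) z) analytic_on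
              {z :: complex. \<bar>Im z\<bar> < h * pi / 2})))"
proof -
  interpret prob_space M by (rule assms(1))
  note [measurable] = assms(2,3)
  have fin: "finite_measure M" by unfold_locales
  have Y: "integrable M Y"
    using assms(4) by (intro integrable_const_bound[of _ 1] AE_I2) force+
  \<comment> \<open>As \<open>fstar\<close> is only a version of a conditional probability, its
    range is controlled only almost everywhere.\<close>
  have fstar_bounds: "AE \<omega> in M. fstar (X \<omega>) \<in> {0..1}"
  proof (rule cond_exp_given_AE_bounds[OF fin assms(2,5)])
    show "integrable M (indicat_real {\<omega> \<in> space M. Y \<omega> = 1})"
      by (intro integrable_const_bound[of _ 1]) (auto simp: indicator_def)
  qed (auto simp: indicator_def)
  have [measurable]: "fstar \<in> borel_measurable N"
    using assms(5) by (simp add: cond_exp_given_def)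
  have fstar_sq: "integrable M (\<lambda>\<omega>. (fstar (X \<omega>))\<^sup>2)"
  proof (rule integrable_const_bound)
    show "AE \<omega> in M. norm ((fstar (X \<omega>))\<^sup>2) \<le> 1"
      using fstar_bounds by (rule eventually_mono) (simp add: power_le_one)
  qed measurable
  have "perturbed_calibration M h X m \<eta>1 analytic_on
      ({z :: complex. \<bar>Im z\<bar> < h * pi / 2} \<inter> {z. 0 \<le> Re z \<and> Re z \<le> 1})"
    if m: "scalar_predictor N m" and \<eta>1: "cond_exp_given M borel (\<lambda>\<omega>. m (X \<omega>)) Y \<eta>1" for m \<eta>1
  proof -
    have [measurable]: "m \<in> borel_measurable N"
      using m by (simp add: scalar_predictor_def)
    have "integrable M (\<lambda>\<omega>. \<eta>1 (m (X \<omega>)))"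
      by (rule cond_exp_given_integrable[OF fin _ \<eta>1 Y]) measurable
    then show ?thesis
      using perturbed_calibration_analytic[OF assms(6,2) m] by (blast intro: analytic_on_subset)
  qed
  \<comment> \<open>Stated for a general \<open>W\<close> to cover \<open>\<eta>1\<close>, with
    \<open>W\<close> equal to \<open>Y\<close>, and \<open>\<eta>2\<close>, with \<open>W\<close>
    the square of \<open>fstar\<close> at \<open>X\<close>.\<close>
  moreover have "integrable M (\<lambda>\<omega>. \<eta> (S (X \<omega>)))"
    if S: "higher_order_predictor N S" and \<eta>: "cond_exp_given M borel (\<lambda>\<omega>. S (X \<omega>)) W \<eta>"
      and W: "integrable M W" for S \<eta> W
  proof -
    have [measurable]: "S \<in> borel_measurable N"
      using S by (simp add: higher_order_predictor_def)
    show ?thesis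
      by (rule cond_exp_given_integrable[OF fin _ \<eta> W]) measurable
  qed
  ultimately show ?thesis
    using perturbed_calibration2_analytic[OF assms(6,2)] Y fstar_sq
    by (intro conjI allI impI ballI) (auto 0 3)
qed

end
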